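(* Let $G$ be a torsion-free abelian group and let $R=\bigoplus_{n\in G}R_n$ be a $G$-graded integral domain. Then every invertible element of $R$ is homogeneous, i.e. lies in $R_n$ for some $n\in G$.
   Context: Integral domains are commutative with identity. A $G$-graded ring is a ring $R$ with a decomposition $R=\bigoplus_{n\in G}R_n$ of its additive group into subgroups with $R_mR_n\subseteq R_{m+n}$ for all $m,n\in G$. A homogeneous element is a nonzero element of some $R_n$. *)

theory Defs
  imports Main
begin

text \<open>The multiple \<open>k \<cdot> g\<close> is written as the constant sum \<open>(\<Sum>_<k. g)\<close>, since the class
  \<^class>\<open>ab_group_add\<close> comes without a scalar multiplication by natural numbers.\<close>

definition torsion_free :: "'g::ab_group_add set \<Rightarrow> bool" where
  "torsion_free G \<longleftrightarrow> (\<forall>g\<in>G. \<forall>k::nat. k > 0 \<and> (\<Sum>_<k. g) = 0 \<longrightarrow> g = 0)"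

definition add_subgroup :: "'a::ab_group_add set \<Rightarrow> bool" where
  "add_subgroup H \<longleftrightarrow> 0 \<in> H \<and> (\<forall>x\<in>H. \<forall>y\<in>H. x + y \<in> H) \<and> (\<forall>x\<in>H. - x \<in> H)"

text \<open>Internal direct sum \<open>\<Oplus>\<^sub>n H n\<close> equal to the whole ambient group: the family \<open>f\<close> of components
  of an element has finite support and is unique. No condition here makes the \<open>H n\<close> subgroups.\<close>

definition direct_sum_decomposition :: "('g \<Rightarrow> 'a::ab_group_add set) \<Rightarrow> bool" where
  "direct_sum_decomposition H \<longleftrightarrow>
     (\<forall>x. \<exists>!f. (\<forall>n. f n \<in> H n) \<and> finite {n. f n \<noteq> 0} \<and> x = (\<Sum>n | f n \<noteq> 0. f n))"

text \<open>The last condition is equivalent to \<open>R\<^sub>m R\<^sub>n \<subseteq> R\<^sub>m\<^sub>+\<^sub>n\<close> whether the left-hand side is read as the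
  set of products or as the subgroup generated by them.\<close>

definition ring_grading :: "('g::ab_group_add \<Rightarrow> 'a::ring set) \<Rightarrow> bool" where
  "ring_grading R \<longleftrightarrow>
     (\<forall>n. add_subgroup (R n)) \<and>
     direct_sum_decomposition R \<and>
     (\<forall>m n. \<forall>x\<in>R m. \<forall>y\<in>R n. x * y \<in> R (m + n))"

definition homogeneous :: "('g \<Rightarrow> 'a::zero set) \<Rightarrow> 'a \<Rightarrow> bool" where
  "homogeneous R x \<longleftrightarrow> x \<noteq> 0 \<and> (\<exists>n. x \<in> R n)"

end

(* A torsion-free abelian group can be ordered, so it has a pointed cone making any given finite
   set of its elements comparable. If u * v = 1, then the sum of the largest degrees of u and v and
   the sum of their smallest degrees are each attained only once, so both are degrees of u * v.
   As 1 has a single degree, the largest and smallest degrees of u agree. *)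
theory Submission
  imports Defs
begin

section \<open>Pointed cones in torsion-free groups\<close>

text \<open>This is the positive cone of a translation-invariant partial order on the group, with
  \<open>y - x \<in> M\<close> read as x \<le> y; pointedness is antisymmetry.\<close>

definition pointed_cone :: "'g::ab_group_add set \<Rightarrow> bool" where
  "pointed_cone M \<longleftrightarrow> 0 \<in> M \<and> (\<forall>x\<in>M. \<forall>y\<in>M. x + y \<in> M) \<and> (\<forall>x\<in>M. - x \<in> M \<longrightarrow> x = 0)"

abbreviation multiple :: "nat \<Rightarrow> 'g::ab_group_add \<Rightarrow> 'g" where
  "multiple k g \<equiv> (\<Sum>_<k. g)"

lemma multiple_add: "multiple (i + j) g = multiple i g + multiple j g"
  by (induction j) (simp_all add: add.assoc)

lemma multiple_commute: "multiple i (multiple j g) = multiple j (multiple i g)"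
  by (rule sum.swap)

lemma pointed_cone_multiple:
  assumes "pointed_cone M" "x \<in> M"
  shows "multiple k x \<in> M"
  using assms by (induction k) (auto simp: pointed_cone_def)

text \<open>Negation reverses the order, so results about largest elements also serve for smallest
  ones.\<close>

lemma pointed_cone_uminus:
  assumes "pointed_cone M"
  shows "pointed_cone (uminus ` M)"
proof -
  have iff: "x \<in> uminus ` M \<longleftrightarrow> - x \<in> M" for x
    by (metis imageE image_eqI minus_minus)
  show ?thesis
    using assms unfolding pointed_cone_def Ball_def iff
    by (metis minus_add_distrib add.commute neg_equal_0_iff_equal)
qed

lemma pointed_cone_add_eq_0:
  assumes "pointed_cone M" "x \<in> M" "y \<in> M" "x + y = 0"
  shows "x = 0" "y = 0"
  using assms unfolding pointed_cone_def
  by (metis add.inverse_unique add_0)+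

text \<open>The cone generated by \<open>M\<close> and \<open>d\<close> consists of the elements
  \<open>a + multiple k d\<close>. If it contains \<open>x\<close> and \<open>- x\<close>, adding
  their expressions gives a relation that \<open>no_rel\<close> excludes unless both multiplicities
  are 0, and then pointedness of \<open>M\<close> applies.\<close>

lemma pointed_cone_adjoin:
  assumes M: "pointed_cone M"
    and no_rel: "\<And>a i. a \<in> M \<Longrightarrow> i > 0 \<Longrightarrow> a + multiple i d \<noteq> 0"
  shows "\<exists>M'. pointed_cone M' \<and> M \<subseteq> M' \<and> d \<in> M'"
proof (intro exI conjI)
  let ?M' = "{a + multiple k d | a k. a \<in> M}"
  show "M \<subseteq> ?M'"
  proof
    fix a assume "a \<in> M"
    then have "a = a + multiple 0 d \<and> a \<in> M" by simp
    then show "a \<in> ?M'" by blast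
  qed
  show "d \<in> ?M'"
  proof -
    have "d = 0 + multiple 1 d \<and> 0 \<in> M" using M by (simp add: pointed_cone_def)
    then show ?thesis by blast
  qed
  show "pointed_cone ?M'"
    unfolding pointed_cone_def
  proof (intro conjI ballI impI)
    show "0 \<in> ?M'"
      using M \<open>M \<subseteq> ?M'\<close> unfolding pointed_cone_def by blast
  next
    fix x y assume "x \<in> ?M'" "y \<in> ?M'"
    then obtain a i b j where *: "x = a + multiple i d" "a \<in> M" "y = b + multiple j d" "b \<in> M"
      by blast
    have "x + y = (a + b) + multiple (i + j) d"
      unfolding multiple_add * by (simp add: algebra_simps)
    moreover have "a + b \<in> M"
      using M * by (auto simp: pointed_cone_def)
    ultimately show "x + y \<in> ?M'" by blast
  next
    fix x assume "x \<in> ?M'" "- x \<in> ?M'"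
    then obtain a i b j where *: "x = a + multiple i d" "a \<in> M" "- x = b + multiple j d" "b \<in> M"
      by blast
    have "(a + b) + multiple (i + j) d = (a + multiple i d) + (b + multiple j d)"
      unfolding multiple_add by (simp add: algebra_simps)
    also have "\<dots> = x + - x"
      by (simp only: *(1)[symmetric] *(3)[symmetric])
    finally have rel: "(a + b) + multiple (i + j) d = 0" by simp
    moreover have "a + b \<in> M"
      using M * by (auto simp: pointed_cone_def)
    ultimately have "\<not> i + j > 0" using no_rel by blast
    then have ij: "i = 0" "j = 0" by simp_all
    with rel have "a + b = 0" by simp
    with pointed_cone_add_eq_0(1)[OF M] * ij show "x = 0" by simp
  qed
qed

text \<open>If neither \<open>d\<close> nor \<open>- d\<close> could be adjoined, there would be
  relations a + i d = 0 and b - j d = 0 with a, b in \<open>M\<close> and i, j positive. Then the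
  elements j a and i b of \<open>M\<close> are opposite, hence 0, and torsion-freeness forces first
  a = 0 and then d = 0.\<close>

lemma pointed_cone_extend:
  assumes tf: "torsion_free (UNIV :: 'g::ab_group_add set)" and M: "pointed_cone (M :: 'g set)"
  shows "\<exists>M'. pointed_cone M' \<and> M \<subseteq> M' \<and> (d \<in> M' \<or> - d \<in> M')"
proof (rule ccontr)
  assume contra: "\<not> ?thesis"
  \<comment> \<open>As 0 lies in \<open>M\<close>, for \<open>d = 0\<close> the cone
    \<open>M\<close> itself would do.\<close>
  have "d \<noteq> 0"
    using contra M by (auto simp: pointed_cone_def)
  obtain a i where a: "a \<in> M" "i > 0" "a + multiple i d = 0"
    using pointed_cone_adjoin[OF M, of d] contra by blast
  obtain b j where b: "b \<in> M" "j > 0" "b + multiple j (- d) = 0"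
    using pointed_cone_adjoin[OF M, of "- d"] contra by blast
  have a_eq: "a = - multiple i d" and b_eq: "b = multiple j d"
    using a(3) b(3) by (simp_all add: eq_neg_iff_add_eq_0 sum_negf)
  have "multiple j a + multiple i b = 0"
    unfolding a_eq b_eq by (simp add: sum_negf multiple_commute[where i = i and j = j])
  then have "multiple j a = 0"
    using pointed_cone_add_eq_0(1)[OF M] pointed_cone_multiple[OF M] a(1) b(1) by blast
  then have "a = 0"
    using tf \<open>j > 0\<close> by (auto simp: torsion_free_def)
  then have "multiple i d = 0" using a_eq by simp
  then show False
    using tf \<open>i > 0\<close> \<open>d \<noteq> 0\<close> by (auto simp: torsion_free_def)
qed

text \<open>Starting from the trivial cone, the elements of \<open>D\<close> are handled one at a
  time; each extension contains the previous cone, so earlier comparisons persist.\<close>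

lemma pointed_cone_comparing:
  assumes tf: "torsion_free (UNIV :: 'g::ab_group_add set)" and "finite (D :: 'g set)"
  shows "\<exists>M. pointed_cone M \<and> (\<forall>d\<in>D. d \<in> M \<or> - d \<in> M)"
  using \<open>finite D\<close>
proof induction
  case empty
  have "pointed_cone {0 :: 'g}" by (simp add: pointed_cone_def)
  then show ?case by blast
next
  case (insert d D)
  then obtain M where M: "pointed_cone M" "\<forall>d\<in>D. d \<in> M \<or> - d \<in> M" by blast
  from pointed_cone_extend[OF tf M(1), of d] M(2) show ?case by blast
qed

lemma pointed_cone_maximum:
  assumes M: "pointed_cone M" and "finite A" "A \<noteq> {}"
    and "\<And>x y. x \<in> A \<Longrightarrow> y \<in> A \<Longrightarrow> x - y \<in> M \<or> y - x \<in> M"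
  shows "\<exists>m\<in>A. \<forall>x\<in>A. m - x \<in> M"
  using assms(2-)
proof (induction rule: finite_ne_induct)
  case (singleton x)
  then show ?case using M by (auto simp: pointed_cone_def)
next
  case (insert x F)
  then obtain m where m: "m \<in> F" "\<forall>y\<in>F. m - y \<in> M" by blast
  have refl: "x - x \<in> M" using M by (simp add: pointed_cone_def)
  consider "m - x \<in> M" | "x - m \<in> M" using insert.prems m(1) by blast
  then show ?case
  proof cases
    case 1
    with m show ?thesis by blast
  next
    case 2
    \<comment> \<open>The new element lies above the old maximum \<open>m\<close>, so transitivity
      through \<open>m\<close> puts it above all of \<open>F\<close>.\<close>
    have "x - y \<in> M" if "y \<in> F" for y
    proof -
      have "(x - m) + (m - y) \<in> M"
        using M 2 m(2) that unfolding pointed_cone_def by blast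
      then show ?thesis by simp
    qed
    with refl show ?thesis by blast
  qed
qed

section \<open>Homogeneous components\<close>

definition is_decomposition :: "('g \<Rightarrow> 'a::ab_group_add set) \<Rightarrow> 'a \<Rightarrow> ('g \<Rightarrow> 'a) \<Rightarrow> bool" where
  "is_decomposition R x f \<longleftrightarrow>
     (\<forall>n. f n \<in> R n) \<and> finite {n. f n \<noteq> 0} \<and> x = (\<Sum>n | f n \<noteq> 0. f n)"

definition component :: "('g \<Rightarrow> 'a::ab_group_add set) \<Rightarrow> 'a \<Rightarrow> 'g \<Rightarrow> 'a" where
  "component R x = (THE f. is_decomposition R x f)"

definition degrees :: "('g \<Rightarrow> 'a::ab_group_add set) \<Rightarrow> 'a \<Rightarrow> 'g set" where
  "degrees R x = {n. component R x n \<noteq> 0}"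

lemma ex1_decomposition: "ring_grading R \<Longrightarrow> \<exists>!f. is_decomposition R x f"
  by (simp add: ring_grading_def direct_sum_decomposition_def is_decomposition_def)

lemma is_decomposition_component: "ring_grading R \<Longrightarrow> is_decomposition R x (component R x)"
  unfolding component_def by (rule theI'[OF ex1_decomposition])

lemma component_eqI: "ring_grading R \<Longrightarrow> is_decomposition R x f \<Longrightarrow> component R x = f"
  unfolding component_def by (rule the1_equality[OF ex1_decomposition])

lemma component_in: "ring_grading R \<Longrightarrow> component R x n \<in> R n"
  using is_decomposition_component[of R x] by (auto simp: is_decomposition_def)

lemma finite_degrees: "ring_grading R \<Longrightarrow> finite (degrees R x)"
  using is_decomposition_component[of R x] by (auto simp: is_decomposition_def degrees_def)

lemma sum_components: "ring_grading R \<Longrightarrow> (\<Sum>n\<in>degrees R x. component R x n) = x"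
  using is_decomposition_component[of R x] by (simp add: is_decomposition_def degrees_def)

lemma degrees_nonempty:
  assumes "ring_grading R" "x \<noteq> 0"
  shows "degrees R x \<noteq> {}"
  using sum_components[OF assms(1), of x] assms(2) by auto

text \<open>The family with \<open>x\<close> in degree \<open>m\<close> and 0 elsewhere is a
  decomposition, so by uniqueness it is the family of components.\<close>

lemma degrees_homogeneous:
  assumes R: "ring_grading R" and x: "x \<in> R m" "x \<noteq> 0"
  shows "degrees R x = {m}"
proof -
  have "is_decomposition R x (\<lambda>n. if n = m then x else 0)"
    using R x by (auto simp: is_decomposition_def ring_grading_def add_subgroup_def)
  from component_eqI[OF R this] x show ?thesis
    by (simp add: degrees_def)
qed

lemma add_subgroup_sum:
  assumes "add_subgroup H" "\<And>i. i \<in> I \<Longrightarrow> f i \<in> H"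
  shows "sum f I \<in> H"
  using assms by (induction I rule: infinite_finite_induct) (auto simp: add_subgroup_def)

text \<open>Expanding the product of the two sums of components and grouping by total degree gives a
  decomposition of \<open>x * y\<close>; uniqueness identifies it with the components.\<close>

lemma component_mult:
  fixes R :: "'g::ab_group_add \<Rightarrow> 'a::ring set"
  assumes R: "ring_grading R"
  shows "component R (x * y) n =
    (\<Sum>(a, b) | (a, b) \<in> degrees R x \<times> degrees R y \<and> a + b = n. component R x a * component R y b)"
proof -
  let ?P = "degrees R x \<times> degrees R y"
  let ?t = "\<lambda>(a, b). component R x a * component R y b"
  define h where "h n = (\<Sum>p\<in>{p\<in>?P. fst p + snd p = n}. ?t p)" for n
  let ?S = "(\<lambda>p. fst p + snd p) ` ?P"
  have fin: "finite ?P" using finite_degrees[OF R] by blast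
  have "h n \<in> R n" for n
    unfolding h_def
    by (rule add_subgroup_sum) (use R component_in[OF R] in \<open>auto simp: ring_grading_def\<close>)
  moreover have sub: "{n. h n \<noteq> 0} \<subseteq> ?S"
  proof
    fix n assume "n \<in> {n. h n \<noteq> 0}"
    then have "{p\<in>?P. fst p + snd p = n} \<noteq> {}"
      unfolding h_def by (metis (mono_tags, lifting) mem_Collect_eq sum.empty)
    then show "n \<in> ?S" by blast
  qed
  moreover have "x * y = (\<Sum>n | h n \<noteq> 0. h n)"
  proof -
    have "x * y = (\<Sum>a\<in>degrees R x. component R x a) * (\<Sum>b\<in>degrees R y. component R y b)"
      by (simp add: sum_components[OF R])
    also have "\<dots> = sum ?t ?P"
      by (simp add: sum_product sum.cartesian_product)
    also have "\<dots> = (\<Sum>n\<in>?S. h n)"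
      unfolding h_def by (rule sum.image_gen[OF fin])
    \<comment> \<open>By cancellation or zero divisors, \<open>h\<close> may vanish at points of
      \<open>?S\<close>; these add nothing to the sum.\<close>
    also have "\<dots> = (\<Sum>n | h n \<noteq> 0. h n)"
      by (rule sum.mono_neutral_right) (use fin sub in auto)
    finally show ?thesis .
  qed
  ultimately have "is_decomposition R (x * y) h"
    using fin by (auto simp: is_decomposition_def intro: finite_subset)
  from component_eqI[OF R this] show ?thesis
    unfolding h_def by (auto intro!: sum.cong)
qed

text \<open>Only one pair contributes to the component in degree \<open>a + b\<close>, which is thus
  a product of two nonzero elements of a domain.\<close>

lemma unique_sum_in_degrees:
  fixes R :: "'g::ab_group_add \<Rightarrow> 'a::idom set"
  assumes R: "ring_grading R" and a: "a \<in> degrees R x" and b: "b \<in> degrees R y"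
    and unique: "\<And>a' b'. \<lbrakk>a' \<in> degrees R x; b' \<in> degrees R y; a' + b' = a + b\<rbrakk> \<Longrightarrow> a' = a \<and> b' = b"
  shows "a + b \<in> degrees R (x * y)"
proof -
  have "{(a', b'). (a', b') \<in> degrees R x \<times> degrees R y \<and> a' + b' = a + b} = {(a, b)}"
    using a b unique by blast
  then have "component R (x * y) (a + b) = component R x a * component R y b"
    using component_mult[OF R, of x y "a + b"] by (simp add: case_prod_unfold)
  with a b show ?thesis by (simp add: degrees_def)
qed

text \<open>Multiplying a nonzero component \<open>x\<close> of 1, of degree m, by 1 shifts every
  degree b of 1 to m + b without overlap; but \<open>x * 1 = x\<close> has only the degree m, so b =
  0.\<close>

lemma degrees_one:
  fixes R :: "'g::ab_group_add \<Rightarrow> 'a::idom set"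
  assumes R: "ring_grading R"
  shows "degrees R 1 = {0}"
proof -
  obtain m where m: "m \<in> degrees R 1"
    using degrees_nonempty[OF R, of 1] by auto
  define x where "x = component R 1 m"
  have x: "degrees R x = {m}"
    using degrees_homogeneous[OF R component_in[OF R]] m by (simp add: x_def degrees_def)
  have "b = 0" if "b \<in> degrees R 1" for b
    using unique_sum_in_degrees[OF R, of m x b 1] x that by simp
  with m show ?thesis by blast
qed

text \<open>The extreme sum is attained only once: if \<open>a' + b' = a + b\<close>, then
  \<open>a - a'\<close> and \<open>b - b'\<close> are elements of the cone with sum 0, so both
  vanish.\<close>

lemma extreme_sum_in_degrees:
  fixes R :: "'g::ab_group_add \<Rightarrow> 'a::idom set"
  assumes R: "ring_grading R" and M: "pointed_cone M"
    and a: "a \<in> degrees R x" "\<And>a'. a' \<in> degrees R x \<Longrightarrow> a - a' \<in> M"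
    and b: "b \<in> degrees R y" "\<And>b'. b' \<in> degrees R y \<Longrightarrow> b - b' \<in> M"
  shows "a + b \<in> degrees R (x * y)"
proof (rule unique_sum_in_degrees[OF R a(1) b(1)])
  fix a' b' assume *: "a' \<in> degrees R x" "b' \<in> degrees R y" "a' + b' = a + b"
  have "(a - a') + (b - b') = 0"
    using *(3) by (simp add: algebra_simps)
  from pointed_cone_add_eq_0[OF M a(2)[OF *(1)] b(2)[OF *(2)] this]
  show "a' = a \<and> b' = b" by simp
qed

theorem lemma5p2:
  fixes R :: "'g::ab_group_add \<Rightarrow> 'a::idom set"
    and u :: 'a
  assumes "torsion_free (UNIV :: 'g set)"
    and "ring_grading R"
    and "u dvd 1"
  shows "homogeneous R u"
proof -
  note R = \<open>ring_grading R\<close>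
  obtain v where uv: "u * v = 1" using \<open>u dvd 1\<close> by (metis dvdE)
  then have "u \<noteq> 0" "v \<noteq> 0" by auto
  let ?A = "degrees R u" and ?B = "degrees R v"
  note fin = finite_degrees[OF R, of u] finite_degrees[OF R, of v]
  note nonempty = degrees_nonempty[OF R \<open>u \<noteq> 0\<close>] degrees_nonempty[OF R \<open>v \<noteq> 0\<close>]
  \<comment> \<open>Comparing these differences with 0 makes the order total on each degree set;
    degrees of \<open>u\<close> are not compared with those of \<open>v\<close>.\<close>
  let ?D = "(\<lambda>(x, y). x - y) ` (?A \<times> ?A \<union> ?B \<times> ?B)"
  have "finite ?D" using fin by simp
  from pointed_cone_comparing[OF assms(1) this]
  obtain M where M: "pointed_cone M" and cmp: "\<forall>d\<in>?D. d \<in> M \<or> - d \<in> M" by blast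
  have cmpA: "x - y \<in> M \<or> y - x \<in> M" if "x \<in> ?A" "y \<in> ?A" for x y
    using bspec[OF cmp, of "x - y"] that by auto
  have cmpB: "x - y \<in> M \<or> y - x \<in> M" if "x \<in> ?B" "y \<in> ?B" for x y
    using bspec[OF cmp, of "x - y"] that by auto
  \<comment> \<open>In the reversed order, the maxima \<open>c\<close> and \<open>d\<close> chosen
    below are the smallest degrees of \<open>u\<close> and \<open>v\<close>.\<close>
  let ?N = "uminus ` M"
  have N: "pointed_cone ?N" by (rule pointed_cone_uminus[OF M])
  have N_iff: "x - y \<in> ?N \<longleftrightarrow> y - x \<in> M" for x y
    by (metis image_eqI imageE minus_diff_eq minus_minus)
  obtain a where a: "a \<in> ?A" "\<And>x. x \<in> ?A \<Longrightarrow> a - x \<in> M"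
    using pointed_cone_maximum[OF M fin(1) nonempty(1)] cmpA by blast
  obtain b where b: "b \<in> ?B" "\<And>x. x \<in> ?B \<Longrightarrow> b - x \<in> M"
    using pointed_cone_maximum[OF M fin(2) nonempty(2)] cmpB by blast
  obtain c where c: "c \<in> ?A" "\<And>x. x \<in> ?A \<Longrightarrow> c - x \<in> ?N"
    using pointed_cone_maximum[OF N fin(1) nonempty(1)] cmpA N_iff by blast
  obtain d where d: "d \<in> ?B" "\<And>x. x \<in> ?B \<Longrightarrow> d - x \<in> ?N"
    using pointed_cone_maximum[OF N fin(2) nonempty(2)] cmpB N_iff by blast
  have "a + b = 0"
    using extreme_sum_in_degrees[OF R M a b] degrees_one[OF R] uv by simp
  moreover have "c + d = 0"
    using extreme_sum_in_degrees[OF R N c d] degrees_one[OF R] uv by simp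
  \<comment> \<open>This writes 0 as the spread of the degrees of \<open>u\<close> plus that of
    \<open>v\<close>; both lie in \<open>M\<close>, so both vanish.\<close>
  moreover have "(a - c) + (b - d) = (a + b) - (c + d)" by simp
  ultimately have "(a - c) + (b - d) = 0" by simp
  from pointed_cone_add_eq_0(1)[OF M a(2)[OF c(1)] b(2)[OF d(1)] this]
  have "a = c" by simp
  \<comment> \<open>Every degree of \<open>u\<close> lies between its smallest one \<open>c\<close>
    and its largest one \<open>a\<close>, which coincide.\<close>
  have "x = a" if "x \<in> ?A" for x
  proof -
    have "(a - x) + (x - a) = 0" by simp
    moreover have "x - a \<in> M" using c(2)[OF that] N_iff \<open>a = c\<close> by blast
    ultimately have "a - x = 0" using pointed_cone_add_eq_0(1)[OF M a(2)[OF that]] by blast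
    then show ?thesis by simp
  qed
  with a(1) have "?A = {a}" by blast
  with sum_components[OF R, of u] have "component R u a = u" by simp
  with component_in[OF R, of u a] \<open>u \<noteq> 0\<close> show ?thesis
    by (auto simp: homogeneous_def)
qed

end
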